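(* For every prime power $q>5$ there exists a non-cyclotomic orthomorphism over $\mathbb{F}_q$, i.e. $\mathscr{D}_{q-1}(q)\neq\emptyset$.
   Context: Let $\mathbb{F}_q$ be the finite field of order $q$. An orthomorphism is a permutation $\theta$ of $\mathbb{F}_q$ such that $x\mapsto\theta(x)-x$ is also a permutation. For $k\mid(q-1)$, fix a generator $g$ of $\mathbb{F}_q^*$ and let $C_{k,i}=\{g^j: j\equiv i\pmod k\}$, $0\le i<k$ (cyclotomy classes of index $k$). A cyclotomic map of index $k$ with multipliers $[a_0,\dots,a_{k-1}]$ is $\theta(0)=0$, $\theta(x)=a_ix$ for $x\in C_{k,i}$. $\mathscr{C}_k(q)$ is the set of orthomorphisms that are cyclotomic maps of index $k$, and $\mathscr{D}_k(q)=\mathscr{C}_k(q)\setminus\bigcup_{\ell<k,\ \ell\mid(q-1)}\mathscr{C}_\ell(q)$. An orthomorphism in $\mathscr{D}_{q-1}(q)$ is called non-cyclotomic (note $\mathscr{C}_{q-1}(q)$ is the set of all orthomorphisms fixing $0$). *)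

theory Defs
  imports "HOL-Number_Theory.Number_Theory" "HOL-Library.Cardinality"
begin

text \<open>The field of order \<open>q\<close> is a type \<open>'a\<close> of class \<open>{field, finite}\<close> with \<open>CARD('a) = q\<close>.
  The chosen generator \<open>g\<close> of its multiplicative group is an explicit parameter.\<close>

definition orthomorphism :: "('a::{field,finite} \<Rightarrow> 'a) \<Rightarrow> bool" where
  "orthomorphism \<theta> \<longleftrightarrow> bij \<theta> \<and> bij (\<lambda>x. \<theta> x - x)"

definition mult_generator :: "'a::{field,finite} \<Rightarrow> bool" where
  "mult_generator g \<longleftrightarrow> {g ^ j |j::nat. True} = UNIV - {0}"

text \<open>The following notions of index \<open>k\<close> are meant for \<open>k dvd CARD('a) - 1\<close>. As \<open>g\<close> has finite order
  \<open>CARD('a) - 1\<close>, natural exponents then give the same classes as integer exponents.\<close>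

definition cyclotomy_class :: "'a::{field,finite} \<Rightarrow> nat \<Rightarrow> nat \<Rightarrow> 'a set" where
  "cyclotomy_class g k i = {g ^ j |j. [j = i] (mod k)}"

definition cyclotomic_map ::
    "'a::{field,finite} \<Rightarrow> nat \<Rightarrow> (nat \<Rightarrow> 'a) \<Rightarrow> ('a \<Rightarrow> 'a) \<Rightarrow> bool" where
  "cyclotomic_map g k a \<theta> \<longleftrightarrow>
     \<theta> 0 = 0 \<and> (\<forall>i<k. \<forall>x\<in>cyclotomy_class g k i. \<theta> x = a i * x)"

definition cyclotomic_orthomorphisms :: "'a::{field,finite} \<Rightarrow> nat \<Rightarrow> ('a \<Rightarrow> 'a) set" where
  "cyclotomic_orthomorphisms g k =
     {\<theta>. orthomorphism \<theta> \<and> (\<exists>a. cyclotomic_map g k a \<theta>)}"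

text \<open>The index \<open>l = 0\<close> never contributes to the union, since \<open>CARD('a) - 1 > 0\<close>.\<close>

definition least_index_orthomorphisms :: "'a::{field,finite} \<Rightarrow> nat \<Rightarrow> ('a \<Rightarrow> 'a) set" where
  "least_index_orthomorphisms g k =
     cyclotomic_orthomorphisms g k -
     (\<Union>l\<in>{l. l < k \<and> l dvd CARD('a) - 1}. cyclotomic_orthomorphisms g l)"

end

theory Submission
  imports Defs
begin

text \<open>An orthomorphism fixing 0 is non-cyclotomic as soon as it commutes with no multiplication
  by a scalar \<open>h \<noteq> 0, 1\<close>.

  In odd characteristic, the pigeonhole principle on the quadratic characters of \<open>a\<close> and \<open>a - 1\<close>
  gives \<open>a \<noteq> b\<close> such that multiplying squares by \<open>a\<close> and non-squares by \<open>b\<close> is an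
  orthomorphism \<open>\<theta>\<close>. Its translate \<open>x \<mapsto> \<theta>(x + 1) - \<theta>(1)\<close> is non-cyclotomic: if it commuted
  with \<open>h\<close>, then \<open>\<theta>\<close> would be equivariant under a homothety about 1 and, being equivariant under
  multiplication by squares, also under their commutator, a nontrivial translation. Every element
  is a difference of two squares, so \<open>\<theta>\<close> would be equivariant under all translations and
  hence linear.

  In characteristic 2, the map \<open>x \<mapsto> x\<^sup>3 + x\<close> has two independent collisions and so misses two
  values \<open>u \<noteq> v\<close>. Then \<open>x \<mapsto> (x\<^sup>4 + x\<^sup>2 + u x) / (u - v)\<close> is an additive orthomorphism
  that is not linear over any subfield other than the prime field.\<close>

section \<open>Least index and scalar equivariance\<close>

lemma mult_generator_nonzero:
  fixes g :: "'a::{field,finite}"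
  assumes "mult_generator g"
  shows "g \<noteq> 0"
proof -
  have "g ^ 1 \<in> {g ^ j |j::nat. True}" by blast
  then show ?thesis using assms unfolding mult_generator_def by auto
qed

lemma mult_generator_obtain_power:
  fixes g :: "'a::{field,finite}"
  assumes "mult_generator g" and "x \<noteq> 0"
  obtains j :: nat where "x = g ^ j"
  using assms unfolding mult_generator_def by blast

text \<open>Multiplication by \<open>g\<close> permutes the nonzero elements, so their product
  absorbs a factor \<open>g\<close> for each of them.\<close>

lemma finite_field_power_eq_1:
  fixes g :: "'a::{field,finite}"
  assumes "g \<noteq> 0"
  shows "g ^ (CARD('a) - 1) = 1"
proof -
  let ?A = "UNIV - {0::'a}"
  have "bij_betw ((*) g) ?A ?A"
    by (rule bij_betw_byWitness[where f' = "\<lambda>x. x / g"]) (use assms in auto)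
  then have "(\<Prod>x\<in>?A. x) = (\<Prod>x\<in>?A. g * x)"
    using prod.reindex_bij_betw[of "(*) g" ?A ?A "\<lambda>x. x"] by simp
  also have "\<dots> = g ^ card ?A * (\<Prod>x\<in>?A. x)"
    by (simp add: prod.distrib)
  finally have "g ^ card ?A = 1" by simp
  then show ?thesis by (simp add: card_Diff_subset)
qed

lemma mult_generator_power_neq_1:
  fixes g :: "'a::{field,finite}"
  assumes "mult_generator g" and "0 < l" and "l < CARD('a) - 1"
  shows "g ^ l \<noteq> 1"
proof
  assume one: "g ^ l = 1"
  have "UNIV - {0} \<subseteq> (^) g ` {..<l}"
  proof
    fix x assume "x \<in> UNIV - {0::'a}"
    then obtain j where j: "x = g ^ j"
      using mult_generator_obtain_power[OF assms(1)] by blast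
    have "g ^ j = g ^ (l * (j div l) + j mod l)" by simp
    also have "\<dots> = g ^ (j mod l)" by (simp only: power_add power_mult one) simp
    finally show "x \<in> (^) g ` {..<l}" using j assms(2) by auto
  qed
  then have "card (UNIV - {0::'a}) \<le> card {..<l}"
    by (meson card_image_le card_mono finite_imageI finite_lessThan le_trans)
  then show False using assms(3) by (simp add: card_Diff_subset)
qed

text \<open>The classes of index q - 1 are singletons, so the quotients
  \<open>\<theta> (g ^ i) / g ^ i\<close> serve as multipliers.\<close>

lemma orthomorphism_in_cyclotomic_full_index:
  fixes g :: "'a::{field,finite}"
  assumes "mult_generator g" and "orthomorphism \<theta>" and "\<theta> 0 = 0"
  shows "\<theta> \<in> cyclotomic_orthomorphisms g (CARD('a) - 1)"
proof -
  have g0: "g \<noteq> 0" by (rule mult_generator_nonzero[OF assms(1)])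
  let ?n = "CARD('a) - 1"
  have mod_exponent: "g ^ j = g ^ (j mod ?n)" for j
  proof -
    have "g ^ j = g ^ (?n * (j div ?n) + j mod ?n)" by simp
    also have "\<dots> = g ^ (j mod ?n)"
      by (simp only: power_add power_mult finite_field_power_eq_1[OF g0]) simp
    finally show ?thesis .
  qed
  have "\<theta> x = \<theta> (g ^ i) / g ^ i * x" if x: "x \<in> cyclotomy_class g ?n i" for i x
  proof -
    obtain j where "x = g ^ j" "j mod ?n = i mod ?n"
      using x unfolding cyclotomy_class_def cong_def by blast
    then have "x = g ^ i" using mod_exponent[of i] mod_exponent[of j] by simp
    then show ?thesis using g0 by simp
  qed
  then have "cyclotomic_map g ?n (\<lambda>i. \<theta> (g ^ i) / g ^ i) \<theta>"
    using assms(3) unfolding cyclotomic_map_def by blast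
  then show ?thesis using assms(2) unfolding cyclotomic_orthomorphisms_def by blast
qed

text \<open>Multiplication by \<open>g ^ l\<close> shifts exponents by \<open>l\<close> and so stays
  inside each class of index \<open>l\<close>, where the multiplier is constant.\<close>

lemma cyclotomic_map_equivariant:
  fixes g :: "'a::{field,finite}"
  assumes "mult_generator g" and "cyclotomic_map g l a \<theta>" and "0 < l"
  shows "\<theta> (g ^ l * x) = g ^ l * \<theta> x"
proof (cases "x = 0")
  case True
  then show ?thesis using assms(2) unfolding cyclotomic_map_def by simp
next
  case False
  then obtain j where j: "x = g ^ j"
    using mult_generator_obtain_power[OF assms(1)] by blast
  have "x \<in> cyclotomy_class g l (j mod l)"
    unfolding cyclotomy_class_def cong_def using j by auto
  moreover have "g ^ l * x \<in> cyclotomy_class g l (j mod l)"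
    unfolding cyclotomy_class_def cong_def using j
    by (intro CollectI exI[of _ "l + j"]) (simp add: power_add)
  moreover have "j mod l < l" using assms(3) by simp
  ultimately have "\<theta> x = a (j mod l) * x" "\<theta> (g ^ l * x) = a (j mod l) * (g ^ l * x)"
    using assms(2) unfolding cyclotomic_map_def by blast+
  then show ?thesis by (simp add: mult_ac)
qed

text \<open>A smaller index \<open>l\<close> would make \<theta> commute with the scalar
  \<open>g ^ l\<close>, which differs from 1 for 0 < l < q - 1.\<close>

lemma least_index_orthomorphismsI:
  fixes g :: "'a::{field,finite}"
  assumes g: "mult_generator g" and \<theta>: "orthomorphism \<theta>" "\<theta> 0 = 0"
    and rigid: "\<And>h. h \<noteq> 0 \<Longrightarrow> (\<And>x. \<theta> (h * x) = h * \<theta> x) \<Longrightarrow> h = 1"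
  shows "\<theta> \<in> least_index_orthomorphisms g (CARD('a) - 1)"
proof -
  have "\<theta> \<notin> cyclotomic_orthomorphisms g l" if l: "l < CARD('a) - 1" "l dvd CARD('a) - 1" for l
  proof
    assume "\<theta> \<in> cyclotomic_orthomorphisms g l"
    then obtain a where a: "cyclotomic_map g l a \<theta>"
      unfolding cyclotomic_orthomorphisms_def by blast
    have "0 < l" using l by (auto intro: Nat.gr0I)
    have "g ^ l = 1"
      using rigid[of "g ^ l"] cyclotomic_map_equivariant[OF g a \<open>0 < l\<close>] mult_generator_nonzero[OF g]
      by simp
    then show False using mult_generator_power_neq_1[OF g \<open>0 < l\<close> l(1)] by contradiction
  qed
  then show ?thesis
    unfolding least_index_orthomorphisms_def
    using orthomorphism_in_cyclotomic_full_index[OF g \<theta>] by blast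
qed

lemma orthomorphismI_inj:
  fixes \<theta> :: "'a::{field,finite} \<Rightarrow> 'a"
  assumes "inj \<theta>" and "inj (\<lambda>x. \<theta> x - x)"
  shows "orthomorphism \<theta>"
  unfolding orthomorphism_def bij_def
  using assms finite_UNIV_inj_surj[of \<theta>] finite_UNIV_inj_surj[of "\<lambda>x. \<theta> x - x"] by auto

lemma orthomorphism_translate:
  assumes "orthomorphism \<theta>"
  shows "orthomorphism (\<lambda>x. \<theta> (x + c) - \<theta> c)"
proof (rule orthomorphismI_inj)
  have inj: "inj \<theta>" "inj (\<lambda>x. \<theta> x - x)"
    using assms unfolding orthomorphism_def bij_def by auto
  show "inj (\<lambda>x. \<theta> (x + c) - \<theta> c)"
    by (rule injI) (simp add: inj_eq[OF inj(1)])
  show "inj (\<lambda>x. \<theta> (x + c) - \<theta> c - x)"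
  proof (rule injI)
    fix x y assume "\<theta> (x + c) - \<theta> c - x = \<theta> (y + c) - \<theta> c - y"
    then have "\<theta> (x + c) - (x + c) = \<theta> (y + c) - (y + c)" by (simp add: algebra_simps)
    then have "x + c = y + c" by (rule injD[OF inj(2)])
    then show "x = y" by simp
  qed
qed

lemma ex_not_in_small_set:
  fixes S :: "'a::finite set"
  assumes "card S < CARD('a)"
  obtains x where "x \<notin> S"
proof -
  have "S \<noteq> UNIV" using assms by auto
  then show thesis using that by blast
qed

section \<open>Odd characteristic\<close>

definition is_sq :: "'a::field \<Rightarrow> bool" where
  "is_sq x \<longleftrightarrow> (\<exists>y. x = y\<^sup>2)"

text \<open>In odd characteristic this is the cyclotomic map of index 2 with multipliers
  \<open>a\<close> and \<open>b\<close>.\<close>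

definition quadratic_map :: "'a::field \<Rightarrow> 'a \<Rightarrow> 'a \<Rightarrow> 'a" where
  "quadratic_map a b x = (if is_sq x then a else b) * x"

lemma is_sq_mult: "is_sq x \<Longrightarrow> is_sq y \<Longrightarrow> is_sq (x * y)"
  unfolding is_sq_def by (metis power_mult_distrib)

lemma is_sq_divide: "is_sq x \<Longrightarrow> is_sq y \<Longrightarrow> is_sq (x / y)"
  unfolding is_sq_def by (metis power_divide)

text \<open>The generator handles two non-squares: both exponents are odd, so their sum is even.
  Otherwise a square factor can be divided out.\<close>

lemma is_sq_mult_iff:
  fixes g x y :: "'a::{field,finite}"
  assumes g: "mult_generator g" and "x \<noteq> 0" "y \<noteq> 0"
  shows "is_sq (x * y) \<longleftrightarrow> (is_sq x \<longleftrightarrow> is_sq y)"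
proof (cases "is_sq x \<or> is_sq y")
  case True
  then show ?thesis
    using is_sq_mult[of x y] is_sq_divide[of "x * y" x] is_sq_divide[of "x * y" y] assms(2,3) by auto
next
  case False
  obtain i j where ij: "x = g ^ i" "y = g ^ j"
    using mult_generator_obtain_power[OF g] assms(2,3) by metis
  have "odd i" "odd j"
    using False ij unfolding is_sq_def by (metis evenE mult.commute power_mult)+
  then have "even (i + j)" by simp
  then have "is_sq (g ^ (i + j))"
    unfolding is_sq_def by (metis evenE mult.commute power_mult)
  then show ?thesis using False ij by (simp add: power_add)
qed

lemma ex_not_sq:
  assumes "(2::'a::{field,finite}) \<noteq> 0"
  shows "\<exists>x::'a. \<not> is_sq x"
proof (rule ccontr)
  assume "\<nexists>x::'a. \<not> is_sq x"
  \<comment> \<open>Squaring would be onto, hence injective by finiteness, yet 1 and -1 have the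
    same square.\<close>
  then have "surj (\<lambda>y::'a. y\<^sup>2)" unfolding is_sq_def surj_def by blast
  then have "inj (\<lambda>y::'a. y\<^sup>2)" using finite_UNIV_surj_inj[of "\<lambda>y::'a. y\<^sup>2"] by simp
  then have "(1::'a) = -1" by (rule injD) simp
  then have "(2::'a) = 0" by (metis add.right_inverse one_add_one)
  then show False using assms by contradiction
qed

text \<open>As \<open>a\<close> and \<open>b\<close> have the same quadratic character, the image of
  a nonzero point reveals whether the point is a square, hence which multiplier was applied.\<close>

lemma inj_quadratic_map:
  fixes g a b :: "'a::{field,finite}"
  assumes g: "mult_generator g" and "a \<noteq> 0" "b \<noteq> 0" "is_sq a = is_sq b"
  shows "inj (quadratic_map a b)"
proof (rule injI)
  fix x y :: 'a
  assume eq: "quadratic_map a b x = quadratic_map a b y"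
  have zero: "quadratic_map a b z = 0 \<longleftrightarrow> z = 0" for z
    using assms unfolding quadratic_map_def by auto
  have sq: "is_sq (quadratic_map a b z) \<longleftrightarrow> (is_sq a \<longleftrightarrow> is_sq z)" if "z \<noteq> 0" for z
    using is_sq_mult_iff[OF g _ that] assms(2-4) unfolding quadratic_map_def by auto
  show "x = y"
  proof (cases "x = 0 \<or> y = 0")
    case True
    then show ?thesis using zero eq by metis
  next
    case False
    then have "is_sq x = is_sq y" using sq eq by metis
    then show ?thesis using eq assms(2,3) unfolding quadratic_map_def by (auto split: if_splits)
  qed
qed

lemma orthomorphism_quadratic_map:
  fixes g a b :: "'a::{field,finite}"
  assumes "mult_generator g" and "a \<noteq> 0" "b \<noteq> 0" "a \<noteq> 1" "b \<noteq> 1"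
    and "is_sq a = is_sq b" "is_sq (a - 1) = is_sq (b - 1)"
  shows "orthomorphism (quadratic_map a b)"
proof (rule orthomorphismI_inj)
  show "inj (quadratic_map a b)" using assms inj_quadratic_map by blast
  have "(\<lambda>x. quadratic_map a b x - x) = quadratic_map (a - 1) (b - 1)"
    unfolding quadratic_map_def by (auto simp: algebra_simps)
  then show "inj (\<lambda>x. quadratic_map a b x - x)"
    using assms inj_quadratic_map[of g "a - 1" "b - 1"] by auto
qed

lemma ex_quadratic_multipliers:
  assumes "6 < CARD('a::{field,finite})"
  obtains a b :: "'a::{field,finite}" where "a \<noteq> b" "a \<noteq> 0" "b \<noteq> 0" "a \<noteq> 1" "b \<noteq> 1"
    "is_sq a = is_sq b" "is_sq (a - 1) = is_sq (b - 1)"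
proof -
  let ?A = "UNIV - {0, 1::'a}" and ?\<chi> = "\<lambda>a::'a. (is_sq a, is_sq (a - 1))"
  have "card (?\<chi> ` ?A) \<le> card (UNIV :: (bool \<times> bool) set)"
    by (rule card_mono) auto
  also have "\<dots> = 4" by (simp add: UNIV_Times_UNIV[symmetric] card_cartesian_product del: UNIV_Times_UNIV)
  \<comment> \<open>At least five candidates compete for four character patterns.\<close>
  also have "\<dots> < card ?A" using assms by (simp add: card_Diff_subset)
  finally have "\<not> inj_on ?\<chi> ?A" by (rule pigeonhole)
  then show thesis using that unfolding inj_on_def by auto
qed

text \<open>Raises the bound q > 5 to the q > 6 of the pigeonhole count.\<close>

lemma not_primepow_6: "\<not> primepow (6::nat)"
proof
  assume "primepow (6::nat)"
  then obtain p k :: nat where p: "prime p" "6 = p ^ k" unfolding primepow_def by blast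
  have "2 dvd p ^ k" "3 dvd p ^ k" by (simp_all flip: p(2))
  moreover have primes: "prime (2::nat)" "prime (3::nat)" by simp_all
  ultimately have "2 dvd p" "3 dvd p" using prime_dvd_power by blast+
  then have "2 = p" "3 = p" using primes p(1) primes_dvd_imp_eq by blast+
  then show False by simp
qed

lemma quadratic_map_translate_rigid:
  fixes g a b h :: "'a::{field,finite}"
  assumes g: "mult_generator g" and two: "(2::'a) \<noteq> 0" and card: "3 < CARD('a)" and ab: "a \<noteq> b"
    and equiv: "\<And>x. quadratic_map a b (h * x + 1) - quadratic_map a b 1
      = h * (quadratic_map a b (x + 1) - quadratic_map a b 1)"
    and h0: "h \<noteq> 0"
  shows "h = 1"
proof (rule ccontr)
  assume h1: "h \<noteq> 1"
  define \<theta> where "\<theta> = quadratic_map a b"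
  \<comment> \<open>Avoiding these three values makes \<open>t\<^sup>2\<close> a square other than 0
    and 1.\<close>
  have "card {0, 1, -1::'a} \<le> 3" by (simp add: card_insert_if)
  then obtain t :: 'a where t: "t \<notin> {0, 1, -1}"
    using card ex_not_in_small_set by (metis le_less_trans)
  define s where "s = t\<^sup>2"
  have s: "s \<noteq> 0" "s \<noteq> 1" "is_sq s"
    using t unfolding s_def is_sq_def by (auto simp: power2_eq_1_iff)
  have scale: "\<theta> (r * x) = r * \<theta> x" if "is_sq r" for r x
  proof (cases "r = 0 \<or> x = 0")
    case False
    then show ?thesis
      using is_sq_mult_iff[OF g, of r x] that unfolding \<theta>_def quadratic_map_def by auto
  qed (auto simp: \<theta>_def quadratic_map_def)
  \<comment> \<open>As 1 is a square, \<open>\<theta> 1 = a\<close>; substituting x = y - 1 turns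
    the hypothesis into equivariance under the homothety about 1 with ratio
    \<open>h\<close>.\<close>
  have "is_sq (1::'a)" unfolding is_sq_def by (metis power_one)
  then have homothety: "\<theta> (h * y + (1 - h)) = h * \<theta> y + (1 - h) * a" for y
    using equiv[of "y - 1"] unfolding \<theta>_def quadratic_map_def[of a b 1]
    by (simp add: algebra_simps)
  \<comment> \<open>For the homothety H(y) = h y + (1 - h) and the scaling S(y) = s y, the
    difference S(H(y)) - H(S(y)) is this constant.\<close>
  define e where "e = (s - 1) * (1 - h)"
  have e: "e \<noteq> 0" using s h1 unfolding e_def by auto
  have translate: "\<theta> (z + e) = \<theta> z + a * e" for z
  proof -
    define y where "y = (z - (1 - h)) / (h * s)"
    have z: "z = h * (s * y) + (1 - h)" using h0 s(1) unfolding y_def by simp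
    have "z + e = s * (h * y + (1 - h))" unfolding z e_def by (simp add: algebra_simps)
    then have "\<theta> (z + e) = s * (h * \<theta> y + (1 - h) * a)"
      using scale[OF s(3)] homothety by simp
    moreover have "\<theta> z = h * (s * \<theta> y) + (1 - h) * a"
      unfolding z using homothety[of "s * y"] scale[OF s(3)] by simp
    ultimately show ?thesis unfolding e_def by (simp add: algebra_simps)
  qed
  \<comment> \<open>Conjugating the translation by \<open>e\<close> with the scaling by a nonzero
    square \<open>r\<close> gives the translation by \<open>r * e\<close>.\<close>
  have translate_sq: "\<theta> (z + r * e) = \<theta> z + a * (r * e)" if r: "is_sq r" for r z
  proof (cases "r = 0")
    case False
    have "z + r * e = r * (z / r + e)" using False by (simp add: algebra_simps)
    then have "\<theta> (z + r * e) = r * (\<theta> (z / r) + a * e)"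
      using scale[OF r] translate by simp
    moreover have "r * \<theta> (z / r) = \<theta> z" using scale[OF r, of "z / r"] False by simp
    ultimately show ?thesis by (simp add: algebra_simps)
  qed simp
  have linear: "\<theta> x = a * x" for x
  proof -
    define w where "w = x / e"
    \<comment> \<open>These squares satisfy m - n = w, so \<open>x\<close> is reached from 0 by
      translations by square multiples of \<open>e\<close>.\<close>
    define m n where "m = ((w + 1) / 2)\<^sup>2" and "n = ((w - 1) / 2)\<^sup>2"
    have "4 * (m - n) = 4 * w"
      using two unfolding m_def n_def by (simp add: power_divide) (simp add: power2_eq_square algebra_simps)
    moreover have "(4::'a) \<noteq> 0" using two by (metis mult_eq_0_iff mult_2 numeral_Bit0)
    ultimately have "w = m - n" by (metis mult_left_cancel)
    then have x: "x + n * e = 0 + m * e" using e unfolding w_def by (simp add: field_simps)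
    have "is_sq m" "is_sq n" unfolding m_def n_def is_sq_def by blast+
    then have "\<theta> x + a * (n * e) = \<theta> 0 + a * (m * e)"
      using translate_sq[of n x] translate_sq[of m 0] x by simp
    moreover have "\<theta> 0 = 0" unfolding \<theta>_def quadratic_map_def by simp
    ultimately show ?thesis using x by (metis add_0 add_right_cancel distrib_left)
  qed
  obtain x :: 'a where x: "\<not> is_sq x" using ex_not_sq[OF two] by blast
  then have "x \<noteq> 0" unfolding is_sq_def by (metis zero_power2)
  then show False using linear[of x] x ab unfolding \<theta>_def quadratic_map_def by simp
qed

section \<open>Characteristic two\<close>

lemma cubic_misses_two_values:
  assumes char2: "(2::'a::{field,finite}) = 0" and card: "4 < CARD('a)"
  obtains u v :: "'a::{field,finite}" where "u \<noteq> v" "u \<notin> range (\<lambda>x. x ^ 3 + x)" "v \<notin> range (\<lambda>x. x ^ 3 + x)"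
proof -
  let ?f = "\<lambda>x::'a. x ^ 3 + x"
  have dbl: "x + x = 0" for x :: 'a using char2 by (metis mult_2 mult_zero_left)
  have eq_iff: "x + y = 0 \<longleftrightarrow> x = y" for x y :: 'a
    by (metis dbl add_right_cancel)
  \<comment> \<open>The third condition makes the denominator of \<open>y\<close> nonzero; the first
    two then keep \<open>x\<close> and \<open>y\<close> distinct and outside {0, 1}.\<close>
  obtain m :: 'a where m: "m \<noteq> 0" "m \<noteq> 1" "m\<^sup>2 + m + 1 \<noteq> 0"
  proof -
    \<comment> \<open>If a root exists, \<open>w\<close> and \<open>w + 1\<close> are all of them;
      if none exists, \<open>w\<close> is arbitrary and the third condition holds anyway.\<close>
    define w where "w = (SOME w::'a. w\<^sup>2 + w + 1 = 0)"
    have "card {0, 1, w, w + 1} \<le> 4" by (simp add: card_insert_if)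
    then obtain m :: 'a where m: "m \<notin> {0, 1, w, w + 1}"
      using card ex_not_in_small_set by (metis le_less_trans)
    have "m\<^sup>2 + m + 1 \<noteq> 0"
    proof
      assume root: "m\<^sup>2 + m + 1 = 0"
      then have w: "w\<^sup>2 + w + 1 = 0" unfolding w_def by (rule someI)
      \<comment> \<open>An identity valid in every commutative ring: the explicit multiple of 2 is
        what characteristic two removes. Later identities follow the same pattern.\<close>
      have "(m + w) * (m + (w + 1)) = (m\<^sup>2 + m + 1) + (w\<^sup>2 + w + 1) + 2 * (m * w - 1)"
        by (simp add: power2_eq_square algebra_simps)
      also have "\<dots> = 0" using root w char2 by simp
      finally have "m = w \<or> m = w + 1" by (simp only: mult_eq_0_iff eq_iff)
      then show False using m by simp
    qed
    then show thesis using that m by auto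
  qed
  \<comment> \<open>the second point of the conic \<open>x\<^sup>2 + x y + y\<^sup>2 = 1\<close> on the line \<open>x = 1 + m y\<close> through \<open>(1, 0)\<close>\<close>
  define y where "y = 1 / (m\<^sup>2 + m + 1)"
  define x where "x = 1 + m * y"
  have yD: "y * (m\<^sup>2 + m + 1) = 1" using m(3) unfolding y_def by simp
  have y0: "y \<noteq> 0" using yD by auto
  have y1: "y \<noteq> 1"
  proof
    assume "y = 1"
    then have "m * (m + 1) = 0" using yD by (simp add: power2_eq_square algebra_simps)
    then have "m = 0 \<or> m = 1" by (simp only: mult_eq_0_iff eq_iff)
    then show False using m by simp
  qed
  have x1: "x \<noteq> 1" using m(1) y0 unfolding x_def by simp
  have x0: "x \<noteq> 0"
  proof
    assume "x = 0"
    have "(m + 1)\<^sup>2 = (m\<^sup>2 + m + 1) * (1 + m * y) + m * (1 - y * (m\<^sup>2 + m + 1))"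
      by (simp add: power2_eq_square algebra_simps)
    then have "(m + 1)\<^sup>2 = 0" using \<open>x = 0\<close> yD unfolding x_def by simp
    then have "m = 1" by (simp only: power_eq_0_iff eq_iff)
    then show False using m by simp
  qed
  have xy: "y \<noteq> x"
  proof
    assume "y = x"
    have "m\<^sup>2 + 2 * m = (m\<^sup>2 + m + 1) * (x - y) + (y * (m\<^sup>2 + m + 1) - 1) * (1 - m)"
      unfolding x_def by (simp add: power2_eq_square algebra_simps)
    then have "m\<^sup>2 = 0" using \<open>y = x\<close> yD char2 by simp
    then show False using m by simp
  qed
  have "?f x - ?f y = (x - y) * (x\<^sup>2 + x * y + y\<^sup>2 + 1)"
    by (simp add: power2_eq_square power3_eq_cube algebra_simps)
  moreover have "x\<^sup>2 + x * y + y\<^sup>2 + 1 = y * (y * (m\<^sup>2 + m + 1) - 1) + 2 * (1 + m * y + y)"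
    unfolding x_def by (simp add: power2_eq_square algebra_simps)
  ultimately have fxy: "?f x = ?f y" using yD char2 by simp
  have f01: "?f 1 = ?f 0" using dbl[of 1] by simp
  have "range ?f \<subseteq> ?f ` (UNIV - {1, x})"
  proof
    fix c assume "c \<in> range ?f"
    then obtain z where z: "c = ?f z" by blast
    show "c \<in> ?f ` (UNIV - {1, x})"
    proof (cases "z = 1")
      case True
      then show ?thesis using z f01 x0 by (intro image_eqI[of _ _ 0]) auto
    next
      case z1: False
      show ?thesis
      proof (cases "z = x")
        case True
        then show ?thesis using z fxy xy y1 by (intro image_eqI[of _ _ y]) auto
      next
        case False
        then show ?thesis using z z1 by blast
      qed
    qed
  qed
  then have "card (range ?f) \<le> card (UNIV - {1, x})"
    by (meson card_image_le card_mono finite le_trans)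
  also have "\<dots> = CARD('a) - 2" using x1 by (simp add: card_Diff_subset)
  finally have le: "card (range ?f) \<le> CARD('a) - 2" .
  then have "card (range ?f) < CARD('a)" using card by linarith
  then obtain u where u: "u \<notin> range ?f" by (rule ex_not_in_small_set)
  have "card (insert u (range ?f)) < CARD('a)"
    using le card u by simp
  then obtain v where "v \<notin> insert u (range ?f)" by (rule ex_not_in_small_set)
  then show thesis using that[of u v] u by blast
qed

text \<open>The quartic is additive in characteristic two, and a nonzero kernel element
  \<open>d\<close> would satisfy \<open>d ^ 3 + d = w\<close>.\<close>

lemma inj_linearized_quartic:
  fixes w k :: "'a::field"
  assumes char2: "(2::'a) = 0" and w: "w \<notin> range (\<lambda>x. x ^ 3 + x)" and k: "k \<noteq> 0"
  shows "inj (\<lambda>x. (x ^ 4 + x\<^sup>2 + w * x) / k)"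
proof (rule injI)
  fix x y :: 'a
  assume "(x ^ 4 + x\<^sup>2 + w * x) / k = (y ^ 4 + y\<^sup>2 + w * y) / k"
  then have eq: "x ^ 4 + x\<^sup>2 + w * x = y ^ 4 + y\<^sup>2 + w * y" using k by simp
  define d where "d = x - y"
  have "d * (d ^ 3 + d + w) = (x ^ 4 + x\<^sup>2 + w * x) - (y ^ 4 + y\<^sup>2 + w * y)
      + 2 * (y ^ 4 - 2 * x ^ 3 * y + 3 * x\<^sup>2 * y\<^sup>2 - 2 * x * y ^ 3 + y\<^sup>2 - x * y)"
    unfolding d_def by (simp add: power2_eq_square power3_eq_cube power4_eq_xxxx algebra_simps)
  also have "\<dots> = 0" using eq char2 by simp
  finally have "d = 0 \<or> d ^ 3 + d + w = 0" by simp
  moreover have "d ^ 3 + d + w \<noteq> 0"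
  proof
    assume "d ^ 3 + d + w = 0"
    moreover have "w + w = 0" using char2 by (metis mult_2 mult_zero_left)
    ultimately have "w = d ^ 3 + d" by (metis add_right_cancel)
    then show False using w by blast
  qed
  ultimately show "x = y" unfolding d_def by simp
qed

lemma linearized_quartic_rigid:
  fixes u k h :: "'a::{field,finite}"
  assumes char2: "(2::'a) = 0" and card: "2 < CARD('a)" and k: "k \<noteq> 0" and h: "h \<noteq> 0"
    and equiv: "\<And>x. ((h * x) ^ 4 + (h * x)\<^sup>2 + u * (h * x)) / k = h * ((x ^ 4 + x\<^sup>2 + u * x) / k)"
  shows "h = 1"
proof -
  have poly: "(h ^ 3 - 1) * x\<^sup>2 + (h - 1) = 0" if x: "x \<noteq> 0" for x
  proof -
    have "(h * x) ^ 4 + (h * x)\<^sup>2 + u * (h * x) = h * (x ^ 4 + x\<^sup>2 + u * x)"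
      using equiv[of x] k by (simp add: field_simps)
    moreover have "h * x\<^sup>2 * ((h ^ 3 - 1) * x\<^sup>2 + (h - 1))
        = (h * x) ^ 4 + (h * x)\<^sup>2 + u * (h * x) - h * (x ^ 4 + x\<^sup>2 + u * x)"
      by (simp add: power2_eq_square power3_eq_cube power4_eq_xxxx algebra_simps)
    ultimately have "h * x\<^sup>2 * ((h ^ 3 - 1) * x\<^sup>2 + (h - 1)) = 0" by simp
    then show ?thesis using h x by simp
  qed
  have "card {0, 1::'a} < CARD('a)" using card by simp
  then obtain x :: 'a where "x \<notin> {0, 1}" by (rule ex_not_in_small_set)
  then have x: "x \<noteq> 0" "x \<noteq> 1" by auto
  \<comment> \<open>Eliminates \<open>h ^ 3 - 1\<close> between the relation \<open>poly\<close> at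
    1 and at \<open>x\<close>.\<close>
  have "(h - 1) * (x - 1)\<^sup>2
      = ((h ^ 3 - 1) * 1\<^sup>2 + (h - 1)) * x\<^sup>2 - ((h ^ 3 - 1) * x\<^sup>2 + (h - 1)) + 2 * ((h - 1) * (1 - x))"
    by (simp add: power2_eq_square power3_eq_cube algebra_simps)
  also have "\<dots> = 0" using poly[of 1] poly[OF x(1)] char2 by simp
  finally show ?thesis using x(2) by simp
qed

text \<open>The divisor \<open>u - v\<close> is chosen so that subtracting the identity replaces
  \<open>u\<close> by \<open>v\<close> in the numerator.\<close>

lemma orthomorphism_linearized_quartic:
  fixes u v :: "'a::{field,finite}"
  assumes char2: "(2::'a) = 0" and "u \<noteq> v"
    and "u \<notin> range (\<lambda>x. x ^ 3 + x)" "v \<notin> range (\<lambda>x. x ^ 3 + x)"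
  shows "orthomorphism (\<lambda>x. (x ^ 4 + x\<^sup>2 + u * x) / (u - v))"
proof (rule orthomorphismI_inj)
  have uv: "u - v \<noteq> 0" using assms(2) by simp
  show "inj (\<lambda>x. (x ^ 4 + x\<^sup>2 + u * x) / (u - v))"
    by (rule inj_linearized_quartic[OF char2 assms(3) uv])
  have "(x ^ 4 + x\<^sup>2 + u * x) / (u - v) - x = (x ^ 4 + x\<^sup>2 + v * x) / (u - v)" for x
    using uv by (simp add: field_simps)
  then show "inj (\<lambda>x. (x ^ 4 + x\<^sup>2 + u * x) / (u - v) - x)"
    using inj_linearized_quartic[OF char2 assms(4) uv] by simp
qed

section \<open>Existence\<close>

theorem theorem3p4:
  fixes q :: nat and g :: "'a::{field,finite}"
  assumes "primepow q" and "q > 5" and "CARD('a) = q" and "mult_generator g"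
  shows "least_index_orthomorphisms g (q - 1) \<noteq> {}"
proof (cases "(2::'a) = 0")
  case True
  obtain u v :: 'a where uv: "u \<noteq> v" "u \<notin> range (\<lambda>x. x ^ 3 + x)" "v \<notin> range (\<lambda>x. x ^ 3 + x)"
    by (rule cubic_misses_two_values[OF True]) (use assms(2,3) in simp)
  define \<theta> where "\<theta> = (\<lambda>x. (x ^ 4 + x\<^sup>2 + u * x) / (u - v))"
  have "\<theta> \<in> least_index_orthomorphisms g (CARD('a) - 1)"
  proof (rule least_index_orthomorphismsI[OF assms(4)])
    show "orthomorphism \<theta>"
      unfolding \<theta>_def by (rule orthomorphism_linearized_quartic[OF True uv])
    show "\<theta> 0 = 0" unfolding \<theta>_def by simp
    fix h assume "h \<noteq> 0" and equiv: "\<And>x. \<theta> (h * x) = h * \<theta> x"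
    have "2 < CARD('a)" "u - v \<noteq> 0" using assms(2,3) uv(1) by simp_all
    then show "h = 1"
      using linearized_quartic_rigid[OF True _ _ \<open>h \<noteq> 0\<close> equiv[unfolded \<theta>_def]] by blast
  qed
  then show ?thesis unfolding assms(3) by blast
next
  case False
  have "q \<noteq> 6" using assms(1) not_primepow_6 by blast
  then have card: "6 < CARD('a)" using assms(2,3) by simp
  obtain a b :: 'a where ab: "a \<noteq> b" "a \<noteq> 0" "b \<noteq> 0" "a \<noteq> 1" "b \<noteq> 1"
    "is_sq a = is_sq b" "is_sq (a - 1) = is_sq (b - 1)"
    by (rule ex_quadratic_multipliers[OF card])
  define \<theta> where "\<theta> = (\<lambda>x. quadratic_map a b (x + 1) - quadratic_map a b 1)"
  have "\<theta> \<in> least_index_orthomorphisms g (CARD('a) - 1)"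
  proof (rule least_index_orthomorphismsI[OF assms(4)])
    show "orthomorphism \<theta>"
      unfolding \<theta>_def
      by (intro orthomorphism_translate orthomorphism_quadratic_map[OF assms(4) ab(2-7)])
    show "\<theta> 0 = 0" unfolding \<theta>_def by simp
    fix h assume "h \<noteq> 0" and equiv: "\<And>x. \<theta> (h * x) = h * \<theta> x"
    have "3 < CARD('a)" using card by simp
    then show "h = 1"
      by (rule quadratic_map_translate_rigid[OF assms(4) False _ ab(1) equiv[unfolded \<theta>_def] \<open>h \<noteq> 0\<close>])
  qed
  then show ?thesis unfolding assms(3) by blast
qed

end
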